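(* Let $G$ be a finite simple graph that is $K_{2,2,2}$-free and hole-edge-disjoint, and let $h(G)$ denote the number of holes of $G$. Suppose there exists a hole $C$ of $G$ such that $|\{e\in E(C): S_{C,e}^{(G)}\neq\emptyset\}|\geq h(G)$. Then $G$ has the chordal property. Consequently, $G$ has a chordal cut.
   Context: A hole is a chordless cycle of length at least $4$. $G$ is hole-edge-disjoint if its holes are pairwise edge-disjoint; $G$ is $K_{2,2,2}$-free if it has no induced subgraph isomorphic to $K_{2,2,2}$. For a hole $C$, let $X_C=\{v\in V(G): uv\in E(G)\text{ for all }u\in V(C)\}$. A path $W$ is $C$-avoiding if (1) none of its internal vertices lies in $V(C)\cup X_C$, and (2) if $W$ has length $1$, at least one of its two vertices is not in $V(C)\cup X_C$. For an edge $e=uv$ of $C$, let $\mathcal{P}_{C,uv}$ be the set of $C$-avoiding $(u,v)$-paths, $X_{C,e}=X_C\cup\{u,v\}$, $S_{C,e}^{(G)}=\bigcup_{P\in\mathcal{P}_{C,uv}}V(P)\setminus\{u,v\}$, $T_{C,e}=\{w: uwv\in\mathcal{P}_{C,uv}\}$. Let $Q_{C,e}$ be the connected component of $G-X_{C,e}$ containing $V(C)\setminus\{u,v\}$, and $U_{C,e}$ the union of those connected components of $G-X_{C,e}-Q_{C,e}$ that contain a vertex of $T_{C,e}$. $G$ has the chordal property if there exist a hole $C$ and $e\in E(C)$ such that $G[V(U_{C,e})\cup X_{C,e}]$ is chordal. A clique cut is a set $X\subseteq V(G)$ with $G[X]$ complete such that $G-X$ has more connected components than $G$; a clique cut $X$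 is a chordal cut if there is a union $U$ of connected components of $G-X$ such that $G[U\cup X]$ is chordal. *)

theory Defs
  imports Main
begin

datatype 'a graph = Graph (verts: "'a set") (edges: "'a set set")

definition finite_simple_graph :: "'a graph \<Rightarrow> bool" where
  "finite_simple_graph G \<longleftrightarrow> finite (verts G) \<and>
     (\<forall>e\<in>edges G. \<exists>u v. e = {u, v} \<and> u \<noteq> v \<and> u \<in> verts G \<and> v \<in> verts G)"

definition induced_subgraph :: "'a graph \<Rightarrow> 'a set \<Rightarrow> 'a graph" where
  "induced_subgraph G S = Graph (verts G \<inter> S) {e \<in> edges G. e \<subseteq> S}"

definition delete_verts :: "'a graph \<Rightarrow> 'a set \<Rightarrow> 'a graph" where
  "delete_verts G X = induced_subgraph G (verts G - X)"

definition isomorphic :: "'a graph \<Rightarrow> 'b graph \<Rightarrow> bool" where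
  "isomorphic G H \<longleftrightarrow> (\<exists>f. bij_betw f (verts G) (verts H) \<and>
     (\<forall>u\<in>verts G. \<forall>v\<in>verts G. {u, v} \<in> edges G \<longleftrightarrow> {f u, f v} \<in> edges H))"

definition complete :: "'a graph \<Rightarrow> bool" where
  "complete G \<longleftrightarrow> (\<forall>u\<in>verts G. \<forall>v\<in>verts G. u \<noteq> v \<longrightarrow> {u, v} \<in> edges G)"

text \<open>The vertex \<open>(i, j)\<close> is the \<open>j\<close>-th vertex of the \<open>i\<close>-th part.\<close>

definition K222 :: "(nat \<times> nat) graph" where
  "K222 = (let V = {0, 1, 2} \<times> {0, 1}
           in Graph V {{x, y} | x y. x \<in> V \<and> y \<in> V \<and> fst x \<noteq> fst y})"

definition K222_free :: "'a graph \<Rightarrow> bool" where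
  "K222_free G \<longleftrightarrow> \<not> (\<exists>S \<subseteq> verts G. isomorphic (induced_subgraph G S) K222)"

text \<open>A path is the list of its vertices; its length is one less than the length of the list.\<close>

definition is_path :: "'a graph \<Rightarrow> 'a list \<Rightarrow> bool" where
  "is_path G p \<longleftrightarrow> p \<noteq> [] \<and> distinct p \<and> set p \<subseteq> verts G \<and>
     (\<forall>i. Suc i < length p \<longrightarrow> {p ! i, p ! Suc i} \<in> edges G)"

definition inner_verts :: "'a list \<Rightarrow> 'a set" where
  "inner_verts p = set (butlast (tl p))"

text \<open>Connected components are represented by their vertex sets.\<close>

definition component_of :: "'a graph \<Rightarrow> 'a \<Rightarrow> 'a set" where
  "component_of G v = {w. \<exists>p. is_path G p \<and> hd p = v \<and> last p = w}"

definition components :: "'a graph \<Rightarrow> 'a set set" where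
  "components G = component_of G ` verts G"

text \<open>Cycles, and hence holes, are subgraphs: the starting point and the orientation of the
  enumeration \<open>vs\<close> are forgotten, so that each hole is counted once.\<close>

definition cycle_graph :: "'a list \<Rightarrow> 'a graph" where
  "cycle_graph vs =
     Graph (set vs) {{vs ! i, vs ! (Suc i mod length vs)} | i. i < length vs}"

definition is_cycle :: "'a graph \<Rightarrow> 'a graph \<Rightarrow> bool" where
  "is_cycle G C \<longleftrightarrow> verts C \<subseteq> verts G \<and> edges C \<subseteq> edges G \<and>
     (\<exists>vs. distinct vs \<and> length vs \<ge> 3 \<and> C = cycle_graph vs)"

definition chordless :: "'a graph \<Rightarrow> 'a graph \<Rightarrow> bool" where
  "chordless G C \<longleftrightarrow> (\<forall>e\<in>edges G. e \<subseteq> verts C \<longrightarrow> e \<in> edges C)"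

definition holes :: "'a graph \<Rightarrow> 'a graph set" where
  "holes G = {C. is_cycle G C \<and> chordless G C \<and> card (edges C) \<ge> 4}"

definition chordal :: "'a graph \<Rightarrow> bool" where
  "chordal G \<longleftrightarrow> holes G = {}"

definition hole_edge_disjoint :: "'a graph \<Rightarrow> bool" where
  "hole_edge_disjoint G \<longleftrightarrow>
     (\<forall>C\<in>holes G. \<forall>D\<in>holes G. C \<noteq> D \<longrightarrow> edges C \<inter> edges D = {})"

text \<open>In the following, \<open>X_hole G C\<close> is $X_C$, while \<open>avoiding_paths G C e\<close>, \<open>X_edge G C e\<close>,
  \<open>S_edge G C e\<close>, \<open>T_edge G C e\<close>, \<open>Q_edge G C e\<close>, \<open>U_edge G C e\<close> are ${\cal P}_{C,uv}$,
  $X_{C,e}$, $S_{C,e}^{(G)}$, $T_{C,e}$, $V(Q_{C,e})$, $V(U_{C,e})$ for the edge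
  \<open>e = {u, v}\<close>. As \<open>e\<close> is unordered, \<open>avoiding_paths\<close> contains each path in both directions.\<close>

definition X_hole :: "'a graph \<Rightarrow> 'a graph \<Rightarrow> 'a set" where
  "X_hole G C = {v \<in> verts G. \<forall>u\<in>verts C. {u, v} \<in> edges G}"

definition avoiding :: "'a graph \<Rightarrow> 'a graph \<Rightarrow> 'a list \<Rightarrow> bool" where
  "avoiding G C p \<longleftrightarrow>
     inner_verts p \<inter> (verts C \<union> X_hole G C) = {} \<and>
     (length p = 2 \<longrightarrow> (\<exists>w\<in>set p. w \<notin> verts C \<union> X_hole G C))"

definition avoiding_paths :: "'a graph \<Rightarrow> 'a graph \<Rightarrow> 'a set \<Rightarrow> 'a list set" where
  "avoiding_paths G C e = {p. is_path G p \<and> {hd p, last p} = e \<and> avoiding G C p}"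

definition X_edge :: "'a graph \<Rightarrow> 'a graph \<Rightarrow> 'a set \<Rightarrow> 'a set" where
  "X_edge G C e = X_hole G C \<union> e"

definition S_edge :: "'a graph \<Rightarrow> 'a graph \<Rightarrow> 'a set \<Rightarrow> 'a set" where
  "S_edge G C e = (\<Union>p\<in>avoiding_paths G C e. set p) - e"

definition T_edge :: "'a graph \<Rightarrow> 'a graph \<Rightarrow> 'a set \<Rightarrow> 'a set" where
  "T_edge G C e = {w. \<exists>u v. e = {u, v} \<and> [u, w, v] \<in> avoiding_paths G C e}"

definition Q_edge :: "'a graph \<Rightarrow> 'a graph \<Rightarrow> 'a set \<Rightarrow> 'a set" where
  "Q_edge G C e =
     (THE K. K \<in> components (delete_verts G (X_edge G C e)) \<and> verts C - e \<subseteq> K)"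

definition U_edge :: "'a graph \<Rightarrow> 'a graph \<Rightarrow> 'a set \<Rightarrow> 'a set" where
  "U_edge G C e =
     \<Union> {K \<in> components (delete_verts (delete_verts G (X_edge G C e)) (Q_edge G C e)).
          K \<inter> T_edge G C e \<noteq> {}}"

definition chordal_property :: "'a graph \<Rightarrow> bool" where
  "chordal_property G \<longleftrightarrow> (\<exists>C\<in>holes G. \<exists>e\<in>edges C.
     chordal (induced_subgraph G (U_edge G C e \<union> X_edge G C e)))"

definition clique_cut :: "'a graph \<Rightarrow> 'a set \<Rightarrow> bool" where
  "clique_cut G X \<longleftrightarrow> X \<subseteq> verts G \<and> complete (induced_subgraph G X) \<and>
     card (components (delete_verts G X)) > card (components G)"

text \<open>The family \<open>\<K>\<close> of components is required to be nonempty: with the empty union, every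
  clique cut would be a chordal cut.\<close>

definition chordal_cut :: "'a graph \<Rightarrow> 'a set \<Rightarrow> bool" where
  "chordal_cut G X \<longleftrightarrow> clique_cut G X \<and>
     (\<exists>\<K> \<subseteq> components (delete_verts G X). \<K> \<noteq> {} \<and>
        chordal (induced_subgraph G (\<Union>\<K> \<union> X)))"

end

theory Submission
  imports Defs
begin

text \<open>
  Let \<open>C\<close> be a hole and \<open>K\<close> a connected set of vertices outside \<open>C\<close> and $X_C$. The neighbours of
  \<open>K\<close> on \<open>C\<close> are pairwise adjacent, since otherwise rerouting \<open>C\<close> through \<open>K\<close> gives a second hole
  sharing an edge with \<open>C\<close>; as \<open>C\<close> has no triangle, they lie on a single edge of \<open>C\<close>. Hence the sets
  $U_{C,e}$ are disjoint for distinct edges \<open>e\<close>, and $X_{C,e}$, a clique because \<open>G\<close> is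
  $K_{2,2,2}$-free and hole-edge-disjoint, separates $U_{C,e}$ from the rest of \<open>C\<close>. If
  $G[U_{C,e} \cup X_{C,e}]$ is not chordal, it contains a hole other than \<open>C\<close>, which meets $U_{C,e}$
  because $X_{C,e}$ is a clique. These holes are distinct for distinct \<open>e\<close>, so fewer than \<open>h(G)\<close>
  edges of \<open>C\<close> can give one.
\<close>

section \<open>Cycles and induced subgraphs\<close>

lemma verts_cycle_graph [simp]: "verts (cycle_graph vs) = set vs"
  by (simp add: cycle_graph_def)

lemma edges_cycle_graph:
  "edges (cycle_graph vs) = (\<lambda>i. {vs ! i, vs ! (Suc i mod length vs)}) ` {..<length vs}"
  by (auto simp: cycle_graph_def)

lemma card_edges_cycle_graph:
  assumes "distinct vs" "3 \<le> length vs"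
  shows "card (edges (cycle_graph vs)) = length vs"
proof -
  let ?n = "length vs"
  have "inj_on (\<lambda>i. {vs ! i, vs ! (Suc i mod ?n)}) {..<?n}"
  proof (rule inj_onI)
    fix i j
    assume ij: "i \<in> {..<?n}" "j \<in> {..<?n}"
      and eq: "{vs ! i, vs ! (Suc i mod ?n)} = {vs ! j, vs ! (Suc j mod ?n)}"
    have "Suc i mod ?n < ?n" "Suc j mod ?n < ?n" using ij by (auto intro: mod_less_divisor)
    with ij eq assms(1) have "i = j \<or> i = Suc j mod ?n \<and> j = Suc i mod ?n"
      by (auto simp: doubleton_eq_iff nth_eq_iff_index_eq)
    then show "i = j" using assms(2) ij by (auto simp: mod_Suc split: if_splits)
  qed
  then show ?thesis by (simp add: edges_cycle_graph card_image)
qed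

lemma nth_edge_cycle_graph_iff:
  assumes "distinct vs" "i < length vs" "j < length vs"
  shows "{vs ! i, vs ! j} \<in> edges (cycle_graph vs) \<longleftrightarrow>
    j = Suc i mod length vs \<or> i = Suc j mod length vs"
proof -
  have "Suc k mod length vs < length vs" for k using assms(2) by (intro mod_less_divisor) auto
  then show ?thesis
    using assms by (auto simp: edges_cycle_graph doubleton_eq_iff nth_eq_iff_index_eq)
qed

lemma cycle_graph_rotate: "cycle_graph (rotate k vs) = cycle_graph vs"
proof -
  have edges_subset: "edges (cycle_graph (rotate k vs)) \<subseteq> edges (cycle_graph vs)"
    for k and vs :: "'a list"
  proof
    fix e assume "e \<in> edges (cycle_graph (rotate k vs))"
    then obtain i where i: "i < length vs"
      "e = {rotate k vs ! i, rotate k vs ! (Suc i mod length vs)}"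
      by (auto simp: edges_cycle_graph)
    have "0 < length vs" using i(1) by linarith
    then have "e = {vs ! ((k + i) mod length vs), vs ! (Suc ((k + i) mod length vs) mod length vs)}"
      using i by (simp add: nth_rotate mod_simps)
    then show "e \<in> edges (cycle_graph vs)"
      using \<open>0 < length vs\<close> by (simp add: edges_cycle_graph)
  qed
  have "rotate (length vs - k mod length vs) (rotate k vs) = vs"
  proof (cases "vs = []")
    case False
    then have "k mod length vs \<le> length vs" by (simp add: less_imp_le)
    then have "(length vs - k mod length vs + k) mod length vs = 0"
      by (metis le_add_diff_inverse2 mod_add_right_eq mod_self)
    then show ?thesis by (simp add: rotate_rotate)
  qed simp
  then have "edges (cycle_graph vs) \<subseteq> edges (cycle_graph (rotate k vs))"
    using edges_subset by metis
  then show ?thesis using edges_subset by (intro graph.expand) auto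
qed

lemma edge_of_hole_subset: "C \<in> holes G \<Longrightarrow> f \<in> edges C \<Longrightarrow> f \<subseteq> verts C"
  by (auto simp: holes_def is_cycle_def cycle_graph_def intro!: nth_mem mod_less_divisor)

lemma verts_hole_subset: "C \<in> holes G \<Longrightarrow> verts C \<subseteq> verts G"
  and edges_hole_subset: "C \<in> holes G \<Longrightarrow> edges C \<subseteq> edges G"
  by (auto simp: holes_def is_cycle_def)

lemma hole_not_subset:
  assumes "C \<in> holes G" "finite A" "card A < 4"
  shows "\<not> verts C \<subseteq> A"
proof
  assume "verts C \<subseteq> A"
  obtain vs where vs: "distinct vs" "3 \<le> length vs" "C = cycle_graph vs"
    using assms(1) by (auto simp: holes_def is_cycle_def)
  have "4 \<le> card (edges C)" using assms(1) by (simp add: holes_def)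
  also have "\<dots> = card (verts C)" using vs by (simp add: card_edges_cycle_graph distinct_card)
  also have "\<dots> \<le> card A" using \<open>verts C \<subseteq> A\<close> assms(2) by (rule card_mono[rotated])
  finally show False using assms(3) by simp
qed

lemma holes_induced_subgraph:
  assumes "D \<in> holes (induced_subgraph G S)"
  shows "D \<in> holes G" "verts D \<subseteq> S"
  using assms by (auto simp: holes_def is_cycle_def chordless_def induced_subgraph_def)

lemma delete_verts_twice:
  "delete_verts (delete_verts G X) Y = induced_subgraph G (verts G - X - Y)"
  by (auto simp: delete_verts_def induced_subgraph_def)

lemma is_path_iff:
  "is_path G p \<longleftrightarrow>
    p \<noteq> [] \<and> distinct p \<and> set p \<subseteq> verts G \<and> successively (\<lambda>x y. {x, y} \<in> edges G) p"
  by (simp add: is_path_def successively_conv_nth)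

lemma is_path_induced_subgraph_iff:
  "is_path (induced_subgraph G S) p \<longleftrightarrow> is_path G p \<and> set p \<subseteq> S"
  unfolding is_path_iff induced_subgraph_def by (auto elim: successively_mono)

lemma isomorphic_induced_subgraph_image:
  assumes "inj_on p (verts H)" "p ` verts H \<subseteq> verts G"
    and edge_iff: "\<And>i j. i \<in> verts H \<Longrightarrow> j \<in> verts H \<Longrightarrow> {p i, p j} \<in> edges G \<longleftrightarrow> {i, j} \<in> edges H"
  shows "isomorphic (induced_subgraph G (p ` verts H)) H"
proof -
  let ?f = "the_inv_into (verts H) p"
  have verts: "verts (induced_subgraph G (p ` verts H)) = p ` verts H"
    using assms(2) by (auto simp: induced_subgraph_def)
  have "bij_betw ?f (p ` verts H) (verts H)"
    using assms(1) by (simp add: bij_betw_the_inv_into inj_on_imp_bij_betw)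
  moreover have "{x, y} \<in> edges (induced_subgraph G (p ` verts H)) \<longleftrightarrow> {?f x, ?f y} \<in> edges H"
    if "x \<in> p ` verts H" "y \<in> p ` verts H" for x y
    using that assms(1) by (auto simp: induced_subgraph_def edge_iff the_inv_into_f_f)
  ultimately show ?thesis unfolding isomorphic_def verts by blast
qed

lemma verts_K222: "verts K222 = {0, 1, 2} \<times> {0, 1}"
  by (simp add: K222_def)

lemma edges_K222_iff:
  "{i, j} \<in> edges K222 \<longleftrightarrow> i \<in> verts K222 \<and> j \<in> verts K222 \<and> fst i \<noteq> fst j"
proof -
  have "(\<exists>x y. {i, j} = {x, y} \<and> x \<in> V \<and> y \<in> V \<and> fst x \<noteq> fst y) \<longleftrightarrow>
      i \<in> V \<and> j \<in> V \<and> fst i \<noteq> fst j" for V :: "(nat \<times> nat) set"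
    unfolding doubleton_eq_iff by metis
  then show ?thesis unfolding K222_def Let_def graph.sel mem_Collect_eq .
qed

section \<open>Connectivity\<close>

lemma card_less_if_disjoint_refinement:
  assumes "pairwise disjnt \<A>" "finite \<B>" "M \<in> \<B>"
    and refine: "\<And>A. A \<in> \<A> \<Longrightarrow> \<exists>B\<in>\<B> - {M}. B \<noteq> {} \<and> B \<subseteq> A"
  shows "card \<A> < card \<B>"
proof -
  obtain f where f: "\<And>A. A \<in> \<A> \<Longrightarrow> f A \<in> \<B> - {M} \<and> f A \<noteq> {} \<and> f A \<subseteq> A"
    using refine by metis
  have "inj_on f \<A>"
  proof (rule inj_onI, rule ccontr)
    fix A B assume "A \<in> \<A>" "B \<in> \<A>" "f A = f B" "A \<noteq> B"
    then have "disjnt A B" using assms(1) by (simp add: pairwise_def)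
    then show False
      using f[OF \<open>A \<in> \<A>\<close>] f[OF \<open>B \<in> \<A>\<close>] \<open>f A = f B\<close> unfolding disjnt_def by blast
  qed
  then have "card \<A> \<le> card (\<B> - {M})"
    using f assms(2) by (intro card_inj_on_le) auto
  also have "\<dots> < card \<B>" using assms(2,3) by (rule card_Diff1_less)
  finally show ?thesis .
qed

locale fin_graph =
  fixes G :: "'a graph"
  assumes finite_simple: "finite_simple_graph G"
begin

abbreviation adj :: "'a \<Rightarrow> 'a \<Rightarrow> bool" where
  "adj x y \<equiv> {x, y} \<in> edges G"

lemma adj_sym: "adj x y \<Longrightarrow> adj y x"
  by (simp add: insert_commute)

lemma adj_irrefl [simp]: "{x} \<notin> edges G"
  using finite_simple by (auto simp: finite_simple_graph_def)

lemma adj_in_verts: "adj x y \<Longrightarrow> x \<in> verts G \<and> y \<in> verts G"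
  using finite_simple by (fastforce simp: finite_simple_graph_def doubleton_eq_iff)

lemma edge_cases:
  assumes "e \<in> edges G"
  obtains x y where "e = {x, y}" "x \<noteq> y" "adj x y"
  using finite_simple assms unfolding finite_simple_graph_def by metis

lemma finite_verts: "finite (verts G)"
  using finite_simple by (simp add: finite_simple_graph_def)

lemma finite_holes: "finite (holes G)"
proof -
  have "edges G \<subseteq> Pow (verts G)"
    using finite_simple by (auto simp: finite_simple_graph_def)
  then have "finite (edges G)" using finite_verts by (simp add: finite_subset)
  moreover have "D \<in> (\<lambda>(V, E). Graph V E) ` (Pow (verts G) \<times> Pow (edges G))"
    if "D \<in> holes G" for D
    using verts_hole_subset[OF that] edges_hole_subset[OF that]
    by (intro image_eqI[of _ _ "(verts D, edges D)"]) auto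
  then have "holes G \<subseteq> (\<lambda>(V, E). Graph V E) ` (Pow (verts G) \<times> Pow (edges G))" by blast
  ultimately show ?thesis using finite_verts by (auto intro: finite_subset)
qed

definition reach :: "'a set \<Rightarrow> 'a \<Rightarrow> 'a \<Rightarrow> bool" where
  "reach A = (\<lambda>x y. x \<in> A \<and> y \<in> A \<and> adj x y)\<^sup>*\<^sup>*"

lemma reach_refl [simp]: "reach A x x"
  by (simp add: reach_def)

lemma reach_trans [trans]: "reach A x y \<Longrightarrow> reach A y z \<Longrightarrow> reach A x z"
  by (simp add: reach_def)

lemma reach_step: "x \<in> A \<Longrightarrow> y \<in> A \<Longrightarrow> adj x y \<Longrightarrow> reach A x y"
  by (auto simp: reach_def)

lemma reach_sym: "reach A x y \<Longrightarrow> reach A y x"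
  unfolding reach_def
  by (rule sympD[OF symp_rtranclp]) (auto simp: symp_def insert_commute)

lemma reach_mono: "reach A x y \<Longrightarrow> A \<subseteq> B \<Longrightarrow> reach B x y"
  unfolding reach_def by (rule rtranclp_mono[THEN predicate2D, rotated]) auto

lemma reach_in: "reach A x y \<Longrightarrow> x \<in> A \<Longrightarrow> y \<in> A"
  unfolding reach_def by (induction rule: rtranclp_induct) auto

lemma reach_induct [consumes 1, case_names refl step]:
  assumes "reach A x y" "P x"
    "\<And>y z. reach A x y \<Longrightarrow> y \<in> A \<Longrightarrow> z \<in> A \<Longrightarrow> adj y z \<Longrightarrow> P y \<Longrightarrow> P z"
  shows "P y"
  using assms unfolding reach_def by (induction rule: rtranclp_induct) blast+

lemma reach_exit:
  assumes "reach A x y" "x \<in> B" "B \<subseteq> A" "\<not> reach B x y"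
  obtains k c where "reach B x k" "k \<in> B" "c \<in> A - B" "adj k c"
proof -
  have "reach B x y \<or> (\<exists>k c. reach B x k \<and> k \<in> B \<and> c \<in> A - B \<and> adj k c)"
    using assms(1)
  proof (induction rule: reach_induct)
    case (step y z)
    show ?case
    proof (cases "reach B x y \<and> z \<in> B")
      case True
      then have "reach B y z" using step.hyps assms(2) reach_in by (intro reach_step) auto
      then show ?thesis using True reach_trans by blast
    next
      case False
      then show ?thesis using step assms(2) reach_in by blast
    qed
  qed simp
  then show thesis using assms(4) that by blast
qed

abbreviation reach_class :: "'a set \<Rightarrow> 'a \<Rightarrow> 'a set" where
  "reach_class A x \<equiv> {y. reach A x y}"

lemma reach_class_eq_iff: "reach_class A x = reach_class A y \<longleftrightarrow> reach A x y"
  using reach_sym reach_trans reach_refl by blast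

lemma reach_class_Diff_reach_class:
  assumes "x \<in> A - reach_class A z"
  shows "reach_class (A - reach_class A z) x = reach_class A x"
proof -
  have "reach (A - reach_class A z) x y" if xy: "reach A x y" for y
  proof (rule ccontr)
    assume "\<not> ?thesis"
    then obtain k c where "k \<in> A - reach_class A z" "c \<in> A \<inter> reach_class A z" "adj k c"
      using reach_exit[OF xy assms] by blast
    moreover from this have "reach A k c" by (intro reach_step) auto
    ultimately show False using reach_sym reach_trans by blast
  qed
  then show ?thesis using reach_mono by blast
qed

definition connected_set :: "'a set \<Rightarrow> bool" where
  "connected_set K \<longleftrightarrow> (\<forall>x\<in>K. \<forall>y\<in>K. reach K x y)"

lemma connected_setD: "connected_set K \<Longrightarrow> K \<subseteq> A \<Longrightarrow> x \<in> K \<Longrightarrow> y \<in> K \<Longrightarrow> reach A x y"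
  unfolding connected_set_def using reach_mono by blast

lemma connected_set_reach_class: "connected_set (reach_class A x)"
proof -
  have "reach (reach_class A x) x y" if "reach A x y" for y
    using that
  proof (induction rule: reach_induct)
    case (step y z)
    then have "reach A x z" using reach_trans[OF step.hyps(1) reach_step] by blast
    with step.hyps have "reach (reach_class A x) y z" by (intro reach_step) simp_all
    with step.IH show ?case by (rule reach_trans)
  qed simp
  then show ?thesis
    unfolding connected_set_def using reach_sym reach_trans by blast
qed

lemma connected_set_walk: "successively adj p \<Longrightarrow> connected_set (set p)"
proof (induction p)
  case (Cons x p)
  show ?case
  proof (cases "p = []")
    case False
    let ?A = "set (x # p)"
    have p: "connected_set (set p)" "adj x (hd p)"
      using Cons False by (auto simp: successively_Cons)
    have "reach ?A x (hd p)" using p(2) False by (intro reach_step) auto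
    moreover have "reach ?A (hd p) y" if "y \<in> set p" for y
      using that False by (intro connected_setD[OF p(1)]) auto
    ultimately have "reach ?A x y" if "y \<in> ?A" for y
      using that reach_trans by auto
    then show ?thesis unfolding connected_set_def using reach_sym reach_trans by blast
  qed (simp add: connected_set_def)
qed (simp add: connected_set_def)

section \<open>Induced paths and components\<close>

definition induced_path :: "'a list \<Rightarrow> bool" where
  "induced_path p \<longleftrightarrow> p \<noteq> [] \<and> distinct p \<and> set p \<subseteq> verts G \<and>
     (\<forall>i<length p. \<forall>j<length p. adj (p ! i) (p ! j) \<longleftrightarrow> j = Suc i \<or> i = Suc j)"

lemma induced_path_nth_adj_iff:
  "induced_path p \<Longrightarrow> i < length p \<Longrightarrow> j < length p \<Longrightarrow>
    adj (p ! i) (p ! j) \<longleftrightarrow> j = Suc i \<or> i = Suc j"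
  by (simp add: induced_path_def)

lemma induced_path_successively: "induced_path p \<Longrightarrow> successively adj p"
  by (simp add: induced_path_def successively_conv_nth)

lemma induced_path_is_path: "induced_path p \<Longrightarrow> is_path G p"
  by (auto simp: induced_path_def is_path_iff induced_path_successively)

lemma induced_path_prefix:
  assumes "induced_path (p @ q)" "p \<noteq> []"
  shows "induced_path p"
  unfolding induced_path_def
proof (intro conjI allI impI)
  fix i j assume "i < length p" "j < length p"
  then show "adj (p ! i) (p ! j) \<longleftrightarrow> j = Suc i \<or> i = Suc j"
    using induced_path_nth_adj_iff[OF assms(1), of i j] by (simp add: nth_append)
qed (use assms in \<open>auto simp: induced_path_def\<close>)

lemma induced_path_snoc:
  assumes p: "induced_path p" and z: "z \<notin> set p" "\<And>x. x \<in> set p \<Longrightarrow> adj x z \<longleftrightarrow> x = last p"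
  shows "induced_path (p @ [z])"
proof -
  have "p \<noteq> []" "distinct p" using p by (auto simp: induced_path_def)
  then have adj_z: "adj (p ! i) z \<longleftrightarrow> Suc i = length p" if "i < length p" for i
    using z(2)[of "p ! i"] that by (auto simp: last_conv_nth nth_eq_iff_index_eq)
  moreover have "adj z (p ! i) \<longleftrightarrow> Suc i = length p" if "i < length p" for i
    using adj_z[OF that] by (simp add: insert_commute)
  moreover have "z \<in> verts G"
    using z(2)[of "last p"] adj_in_verts \<open>p \<noteq> []\<close> by auto
  ultimately show ?thesis
    using p z(1) unfolding induced_path_def by (auto simp: nth_append less_Suc_eq)
qed

lemma induced_path_extend:
  assumes p: "induced_path p" and z: "adj (last p) z"
  obtains q where "induced_path q" "hd q = hd p" "last q = z" "set q \<subseteq> insert z (set p)"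
proof (cases "z \<in> set p")
  case True
  then obtain p1 p2 where split: "p = (p1 @ [z]) @ p2" by (auto dest: split_list)
  show thesis
  proof
    show "induced_path (p1 @ [z])" using induced_path_prefix p split by blast
    show "hd (p1 @ [z]) = hd p" by (cases p1) (auto simp: split)
  qed (auto simp: split)
next
  case False
  have "\<exists>x\<in>set p. adj x z" using p z by (auto simp: induced_path_def)
  then obtain p1 x p2
    where split: "p = p1 @ x # p2" and x: "adj x z" "\<forall>y\<in>set p1. \<not> adj y z"
    by (rule split_list_first_propE)
  have "induced_path (p1 @ [x])" using induced_path_prefix[of "p1 @ [x]" p2] p split by simp
  then have "induced_path ((p1 @ [x]) @ [z])"
    by (rule induced_path_snoc) (use False x in \<open>auto simp: split\<close>)
  moreover have "hd ((p1 @ [x]) @ [z]) = hd p" by (cases p1) (auto simp: split)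
  ultimately show thesis by (rule that) (auto simp: split)
qed

lemma reach_induced_path:
  assumes "reach A x y" "x \<in> A" "x \<in> verts G"
  obtains p where "induced_path p" "set p \<subseteq> A" "hd p = x" "last p = y"
proof -
  have "\<exists>p. induced_path p \<and> set p \<subseteq> A \<and> hd p = x \<and> last p = y"
    using assms(1)
  proof (induction rule: reach_induct)
    case refl
    show ?case using assms(2,3) by (intro exI[of _ "[x]"]) (simp add: induced_path_def)
  next
    case (step y z)
    then obtain p where p: "induced_path p" "set p \<subseteq> A" "hd p = x" "last p = y" by blast
    obtain q where "induced_path q" "hd q = hd p" "last q = z" "set q \<subseteq> insert z (set p)"
      using induced_path_extend[OF p(1), of z] p(4) step.hyps by blast
    then show ?case using p step.hyps by blast
  qed
  then show thesis using that by blast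
qed

lemma component_of_induced:
  assumes "v \<in> A" "A \<subseteq> verts G"
  shows "component_of (induced_subgraph G A) v = reach_class A v"
proof (intro set_eqI iffI)
  fix w assume "w \<in> component_of (induced_subgraph G A) v"
  then obtain p where p: "is_path G p" "set p \<subseteq> A" "hd p = v" "last p = w"
    by (auto simp: component_of_def is_path_induced_subgraph_iff)
  then have "connected_set (set p)" "p \<noteq> []" by (auto simp: is_path_iff connected_set_walk)
  then have "reach A (hd p) (last p)" using p(2) by (intro connected_setD) auto
  then show "w \<in> reach_class A v" using p by simp
next
  fix w assume "w \<in> reach_class A v"
  then obtain p where "induced_path p" "set p \<subseteq> A" "hd p = v" "last p = w"
    using reach_induced_path assms by blast
  then show "w \<in> component_of (induced_subgraph G A) v"
    using induced_path_is_path by (auto simp: component_of_def is_path_induced_subgraph_iff)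
qed

lemma components_induced:
  assumes "A \<subseteq> verts G"
  shows "components (induced_subgraph G A) = reach_class A ` A"
  using assms component_of_induced unfolding components_def
  by (auto simp: induced_subgraph_def Int_absorb1)

lemma components_eq: "components G = reach_class (verts G) ` verts G"
proof -
  have "e \<subseteq> verts G" if "e \<in> edges G" for e
    using finite_simple that by (auto simp: finite_simple_graph_def)
  then have "induced_subgraph G (verts G) = G"
    by (intro graph.expand) (auto simp: induced_subgraph_def)
  then show ?thesis using components_induced[of "verts G"] by simp
qed

lemma pairwise_disjnt_components: "pairwise disjnt (components G)"
proof (rule pairwiseI)
  fix K L assume "K \<in> components G" "L \<in> components G" "K \<noteq> L"
  then obtain x y where classes: "K = reach_class (verts G) x" "L = reach_class (verts G) y"
    by (auto simp: components_eq)
  then have "\<not> reach (verts G) x y" using \<open>K \<noteq> L\<close> reach_class_eq_iff by blast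
  then show "disjnt K L"
    unfolding classes disjnt_iff using reach_sym reach_trans by blast
qed

lemma components_delete: "components (delete_verts G X) = reach_class (verts G - X) ` (verts G - X)"
  unfolding delete_verts_def by (rule components_induced) blast

lemma reach_beyond_clique:
  assumes clique: "pairwise adj X"
    and xy: "x \<in> verts G - X" "y \<in> verts G - X" "reach (verts G) x y" "\<not> reach (verts G - X) x y"
    and z: "z \<in> verts G"
  obtains w where "w \<in> verts G - X" "\<not> reach (verts G - X) x w" "reach (verts G) z w"
proof -
  let ?V = "verts G" and ?R = "verts G - X"
  obtain k u where "reach ?R x k" "k \<in> ?R" "u \<in> ?V - ?R" "adj k u"
    by (rule reach_exit[OF xy(3,1) _ xy(4)]) auto
  then have u: "u \<in> X" "reach ?V x k" "reach ?V k u"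
    using reach_mono by (auto intro: reach_step)
  then have uy: "reach ?V u y" using xy(3) reach_sym reach_trans by blast
  consider "z \<in> ?R" "\<not> reach ?R x z" | "reach ?R x z" | "z \<in> X" using z by blast
  then show thesis
  proof cases
    case 1
    then show thesis by (rule that) simp
  next
    case 2
    then have "reach ?V z x" using reach_sym reach_mono[of ?R x z ?V] by blast
    then have "reach ?V z y" using xy(3) by (rule reach_trans)
    with xy(2,4) show thesis by (rule that)
  next
    case 3
    have "reach ?V z u"
      using 3 u(1) z clique reach_step[of z ?V u] adj_in_verts[of z u]
      by (cases "z = u") (auto simp: pairwise_def)
    then have "reach ?V z y" using uy by (rule reach_trans)
    with xy(2,4) show thesis by (rule that)
  qed
qed

lemma clique_cut_if_separates:
  assumes X: "X \<subseteq> verts G" "pairwise adj X"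
    and xy: "x \<in> verts G - X" "y \<in> verts G - X" "reach (verts G) x y" "\<not> reach (verts G - X) x y"
  shows "clique_cut G X"
proof -
  let ?V = "verts G" and ?R = "verts G - X"
  have "card (components G) < card (components (delete_verts G X))"
  proof (rule card_less_if_disjoint_refinement)
    show "pairwise disjnt (components G)" by (rule pairwise_disjnt_components)
    show "finite (components (delete_verts G X))"
      using finite_verts by (simp add: components_delete)
    show "reach_class ?R x \<in> components (delete_verts G X)"
      using xy(1) by (simp add: components_delete)
    fix K assume "K \<in> components G"
    then obtain z where z: "z \<in> ?V" "K = reach_class ?V z" by (auto simp: components_eq)
    obtain w where w: "w \<in> ?R" "\<not> reach ?R x w" "reach ?V z w"
      by (rule reach_beyond_clique[OF X(2) xy z(1)])
    have "reach_class ?R w \<noteq> reach_class ?R x"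
      using w(2) reach_sym by (auto simp: reach_class_eq_iff)
    moreover have "reach_class ?R w \<subseteq> K"
      using z(2) reach_trans[OF w(3) reach_mono[of ?R w _ ?V]] by blast
    moreover have "reach_class ?R w \<noteq> {}" using reach_refl by blast
    ultimately show "\<exists>L\<in>components (delete_verts G X) - {reach_class ?R x}. L \<noteq> {} \<and> L \<subseteq> K"
      using w(1) by (intro bexI[of _ "reach_class ?R w"]) (simp_all add: components_delete)
  qed
  moreover have "complete (induced_subgraph G X)"
    using X(2) by (auto simp: complete_def induced_subgraph_def pairwise_def)
  ultimately show ?thesis using X(1) by (simp add: clique_cut_def)
qed

section \<open>Holes as closed induced paths\<close>

definition induced_cycle :: "'a \<Rightarrow> 'a list \<Rightarrow> bool" where
  "induced_cycle y r \<longleftrightarrow> y \<in> verts G - set r \<and> 3 \<le> length r \<and> induced_path r \<and>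
     (\<forall>x\<in>set r. adj y x \<longleftrightarrow> x = hd r \<or> x = last r)"

lemma hole_adj_iff:
  assumes "C \<in> holes G" "x \<in> verts C" "y \<in> verts C"
  shows "adj x y \<longleftrightarrow> {x, y} \<in> edges C"
  using assms by (auto simp: holes_def is_cycle_def chordless_def)

lemma cycle_graph_in_holes_iff:
  assumes "distinct vs" "4 \<le> length vs"
  shows "cycle_graph vs \<in> holes G \<longleftrightarrow> set vs \<subseteq> verts G \<and>
    (\<forall>x\<in>set vs. \<forall>y\<in>set vs. adj x y \<longleftrightarrow> {x, y} \<in> edges (cycle_graph vs))"
    (is "_ \<longleftrightarrow> _ \<and> ?adj_iff")
proof (intro iffI conjI)
  assume "set vs \<subseteq> verts G \<and> ?adj_iff"
  then have sub: "set vs \<subseteq> verts G" and adj_iff: ?adj_iff by auto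
  have "edges (cycle_graph vs) \<subseteq> edges G"
  proof
    fix e assume e: "e \<in> edges (cycle_graph vs)"
    then obtain i where i: "i < length vs" "e = {vs ! i, vs ! (Suc i mod length vs)}"
      by (auto simp: edges_cycle_graph)
    moreover have "vs ! (Suc i mod length vs) \<in> set vs"
      using i(1) by (intro nth_mem mod_less_divisor) auto
    ultimately show "e \<in> edges G" using e adj_iff by simp
  qed
  moreover have "chordless G (cycle_graph vs)"
    unfolding chordless_def
  proof (intro ballI impI)
    fix e assume e: "e \<in> edges G" "e \<subseteq> verts (cycle_graph vs)"
    obtain x y where "e = {x, y}" using edge_cases[OF e(1)] by blast
    then show "e \<in> edges (cycle_graph vs)" using e adj_iff by simp
  qed
  ultimately show "cycle_graph vs \<in> holes G"
    using assms sub card_edges_cycle_graph[of vs] by (auto simp: holes_def is_cycle_def)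
next
  assume hole: "cycle_graph vs \<in> holes G"
  show "set vs \<subseteq> verts G" using verts_hole_subset[OF hole] by simp
  show ?adj_iff using hole_adj_iff[OF hole] by simp
qed

lemma cycle_graph_in_holes_iff_induced_cycle:
  assumes "distinct (y # r)" "3 \<le> length r"
  shows "cycle_graph (y # r) \<in> holes G \<longleftrightarrow> induced_cycle y r"
proof -
  let ?E = "edges (cycle_graph (y # r))"
  have ne: "r \<noteq> []" using assms(2) by auto
  have Suc_mod: "Suc (Suc i) mod length (y # r) = (if Suc i = length r then 0 else Suc (Suc i))"
    if "i < length r" for i
    using that by auto
  have path_edge_iff: "{r ! i, r ! j} \<in> ?E \<longleftrightarrow> j = Suc i \<or> i = Suc j"
    if "i < length r" "j < length r" for i j
    using nth_edge_cycle_graph_iff[OF assms(1), of "Suc i" "Suc j"] that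
    unfolding Suc_mod[OF that(1)] Suc_mod[OF that(2)] by (auto split: if_splits)
  have y_edge_iff: "{y, r ! i} \<in> ?E \<longleftrightarrow> r ! i = hd r \<or> r ! i = last r" if "i < length r" for i
    using nth_edge_cycle_graph_iff[OF assms(1), of 0 "Suc i"] that assms(1) ne
    unfolding Suc_mod[OF that] by (auto simp: hd_conv_nth last_conv_nth nth_eq_iff_index_eq)
  have no_loop: "{y} \<notin> ?E"
    using nth_edge_cycle_graph_iff[OF assms(1), of 0 0] ne by simp
  have "(\<forall>x\<in>set (y # r). \<forall>z\<in>set (y # r). adj x z \<longleftrightarrow> {x, z} \<in> ?E) \<longleftrightarrow>
      (\<forall>x\<in>set r. adj y x \<longleftrightarrow> {y, x} \<in> ?E) \<and> (\<forall>x\<in>set r. \<forall>z\<in>set r. adj x z \<longleftrightarrow> {x, z} \<in> ?E)"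
    using no_loop by (auto simp: insert_commute)
  also have "\<dots> \<longleftrightarrow> (\<forall>x\<in>set r. adj y x \<longleftrightarrow> x = hd r \<or> x = last r) \<and>
      (\<forall>i<length r. \<forall>j<length r. adj (r ! i) (r ! j) \<longleftrightarrow> j = Suc i \<or> i = Suc j)"
    by (simp add: all_set_conv_all_nth path_edge_iff y_edge_iff)
  finally show ?thesis
    using assms ne by (subst cycle_graph_in_holes_iff)
      (auto simp: induced_cycle_def induced_path_def)
qed

lemma hole_induced_cycle:
  assumes C: "C \<in> holes G" and y: "y \<in> verts C"
  obtains r where "C = cycle_graph (y # r)" "induced_cycle y r"
proof -
  obtain vs where vs: "distinct vs" "3 \<le> length vs" "C = cycle_graph vs"
    using C by (auto simp: holes_def is_cycle_def)
  then have len: "4 \<le> length vs" using C card_edges_cycle_graph[of vs] by (simp add: holes_def)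
  obtain k where k: "k < length vs" "vs ! k = y" using y vs by (auto simp: in_set_conv_nth)
  then have "hd (rotate k vs) = y" by (subst hd_rotate_conv_nth) auto
  moreover have "rotate k vs \<noteq> []" using len by auto
  ultimately obtain r where r: "rotate k vs = y # r" by (metis list.collapse)
  have "C = cycle_graph (y # r)" using vs cycle_graph_rotate r by metis
  moreover have "distinct (y # r)" using vs(1) r by (metis distinct_rotate)
  moreover have "3 \<le> length r" using len r length_rotate[of k vs] by simp
  ultimately show thesis using that C cycle_graph_in_holes_iff_induced_cycle by metis
qed

lemma induced_cycle_ends_not_adj:
  assumes "induced_cycle y r"
  shows "hd r \<noteq> last r" "\<not> adj (hd r) (last r)"
proof -
  have r: "induced_path r" "3 \<le> length r" "r \<noteq> []" "distinct r"
    using assms by (auto simp: induced_cycle_def induced_path_def)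
  then show "hd r \<noteq> last r" by (simp add: hd_conv_nth last_conv_nth nth_eq_iff_index_eq)
  show "\<not> adj (hd r) (last r)"
    using r induced_path_nth_adj_iff[OF r(1), of 0 "length r - 1"]
    by (auto simp: hd_conv_nth last_conv_nth)
qed

lemma hole_neighbours:
  assumes "C \<in> holes G" "y \<in> verts C"
  obtains p q where "p \<in> verts C" "q \<in> verts C" "p \<noteq> q" "\<not> adj p q"
    "\<forall>x\<in>verts C. adj y x \<longleftrightarrow> x = p \<or> x = q"
proof -
  obtain r where r: "C = cycle_graph (y # r)" "induced_cycle y r"
    by (rule hole_induced_cycle[OF assms])
  then have "r \<noteq> []" "y \<notin> set r" "\<forall>x\<in>set r. adj y x \<longleftrightarrow> x = hd r \<or> x = last r"
    by (auto simp: induced_cycle_def)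
  moreover from this have "y \<noteq> hd r" "y \<noteq> last r" by auto
  ultimately show thesis
    using induced_cycle_ends_not_adj[OF r(2)] r(1) by (intro that[of "hd r" "last r"]) auto
qed

lemma hole_no_triangle:
  assumes "C \<in> holes G" "x \<in> verts C" "y \<in> verts C" "z \<in> verts C" "adj x y" "adj x z"
  shows "\<not> adj y z"
proof -
  obtain p q where "p \<in> verts C" "q \<in> verts C" "p \<noteq> q" "\<not> adj p q"
    "\<forall>w\<in>verts C. adj x w \<longleftrightarrow> w = p \<or> w = q"
    by (rule hole_neighbours[OF assms(1,2)])
  then show ?thesis using assms(3-) adj_sym[of y z] by auto
qed

lemma hole_clique_eq_doubleton:
  assumes "C \<in> holes G" "S \<subseteq> verts C" "pairwise adj S" "x \<in> S" "y \<in> S" "x \<noteq> y"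
  shows "S = {x, y}"
proof -
  have "z \<in> {x, y}" if "z \<in> S" for z
  proof (rule ccontr)
    assume "z \<notin> {x, y}"
    then have "adj x y" "adj x z" "adj y z" using assms(3-) that by (auto simp: pairwise_def)
    then show False using hole_no_triangle[of C x y z] assms that by blast
  qed
  then show ?thesis using assms(4,5) by blast
qed

lemma hole_nonempty: "C \<in> holes G \<Longrightarrow> verts C \<noteq> {}"
  using hole_not_subset[of C G "{}"] by auto

lemma hole_not_clique:
  assumes "C \<in> holes G"
  shows "\<not> pairwise adj (verts C)"
proof -
  obtain y where "y \<in> verts C" using hole_nonempty[OF assms] by blast
  then obtain p q where "p \<in> verts C" "q \<in> verts C" "p \<noteq> q" "\<not> adj p q"
    using hole_neighbours[OF assms] by metis
  then show ?thesis by (auto simp: pairwise_def)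
qed

lemma hole_other_neighbour:
  assumes "C \<in> holes G" "x \<in> verts C" "y \<in> verts C" "adj x y"
  obtains z where "z \<in> verts C" "z \<noteq> y" "adj x z" "\<not> adj y z"
proof -
  obtain p q where "p \<in> verts C" "q \<in> verts C" "p \<noteq> q" "\<not> adj p q"
    "\<forall>w\<in>verts C. adj x w \<longleftrightarrow> w = p \<or> w = q"
    by (rule hole_neighbours[OF assms(1,2)])
  then show thesis using that[of p] that[of q] assms(3,4) by (auto simp: insert_commute)
qed

lemma hole_consecutive:
  assumes C: "C \<in> holes G"
  obtains a b c d where "{a, b, c, d} \<subseteq> verts C" "adj a b" "adj b c" "adj c d"
    "a \<noteq> c" "\<not> adj a c" "b \<noteq> d" "\<not> adj b d"
proof -
  obtain b where b: "b \<in> verts C" using hole_nonempty[OF C] by blast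
  obtain a c where ac: "a \<in> verts C" "c \<in> verts C" "a \<noteq> c" "\<not> adj a c" "adj b a" "adj b c"
    using hole_neighbours[OF C b] by metis
  obtain d where "d \<in> verts C" "d \<noteq> b" "adj c d" "\<not> adj b d"
    using hole_other_neighbour[OF C ac(2) b] ac(6) adj_sym by blast
  then show thesis using that[of a b c d] b ac adj_sym by auto
qed

lemma hole_edge_not_in_two_cliques:
  assumes C: "C \<in> holes G" and cliques: "pairwise adj N" "pairwise adj M"
  obtains x y where "x \<in> verts C" "y \<in> verts C" "adj x y" "\<not> {x, y} \<subseteq> N" "\<not> {x, y} \<subseteq> M"
proof -
  obtain a b c d where path: "{a, b, c, d} \<subseteq> verts C" "adj a b" "adj b c" "adj c d"
    and diag: "a \<noteq> c" "\<not> adj a c" "b \<noteq> d" "\<not> adj b d"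
    by (rule hole_consecutive[OF C])
  have "\<not> {a, c} \<subseteq> S" "\<not> {b, d} \<subseteq> S" if "pairwise adj S" for S
    using that diag by (auto simp: pairwise_def)
  then have "\<not> {a, c} \<subseteq> N" "\<not> {b, d} \<subseteq> N" "\<not> {a, c} \<subseteq> M" "\<not> {b, d} \<subseteq> M"
    using cliques by blast+
  then consider "\<not> {a, b} \<subseteq> N" "\<not> {a, b} \<subseteq> M" | "\<not> {b, c} \<subseteq> N" "\<not> {b, c} \<subseteq> M"
    | "\<not> {c, d} \<subseteq> N" "\<not> {c, d} \<subseteq> M"
    by blast
  then show thesis using that path by cases auto
qed

lemma hole_minus_edge_connected:
  assumes C: "C \<in> holes G" and uv: "{u, v} \<in> edges C"
  shows "connected_set (verts C - {u, v})"
proof -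
  have in_C: "u \<in> verts C" "v \<in> verts C" using edge_of_hole_subset[OF C uv] by auto
  obtain r where r: "C = cycle_graph (u # r)" "induced_cycle u r"
    by (rule hole_induced_cycle[OF C in_C(1)])
  have path: "induced_path r" "r \<noteq> []" "u \<notin> set r"
    and ends: "\<And>x. x \<in> set r \<Longrightarrow> adj u x \<longleftrightarrow> x = hd r \<or> x = last r"
    using r(2) by (auto simp: induced_cycle_def induced_path_def)
  have "adj u v" using hole_adj_iff[OF C in_C] uv by simp
  then have "v \<in> set r" using in_C(2) r(1) by auto
  then consider "v = hd r" | "v = last r" using ends \<open>adj u v\<close> by blast
  then show ?thesis
  proof cases
    case 1
    then obtain s where s: "r = v # s" using path(2) by (metis list.collapse)
    have "verts C - {u, v} = set s" using r(1) path s by (auto simp: induced_path_def)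
    moreover have "successively adj s"
      using induced_path_successively[OF path(1)] s by (auto simp: successively_Cons)
    ultimately show ?thesis using connected_set_walk by simp
  next
    case 2
    then obtain s where s: "r = s @ [v]" using path(2) by (metis append_butlast_last_id)
    have "verts C - {u, v} = set s" using r(1) path s by (auto simp: induced_path_def)
    moreover have "successively adj s"
      using induced_path_successively[OF path(1)] s by (auto simp: successively_append_iff)
    ultimately show ?thesis using connected_set_walk by simp
  qed
qed

lemma induced_path_split_between:
  assumes r: "induced_path r" and ab: "a \<in> set r" "b \<in> set r" "a \<noteq> b" "\<not> adj a b"
  obtains p m q where "r = p @ m # q" "a \<in> set p \<and> b \<in> set q \<or> b \<in> set p \<and> a \<in> set q"
proof -
  have ordered: "\<exists>p m q. r = p @ m # q \<and> x \<in> set p \<and> y \<in> set q"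
    if split: "r = s @ x # t" and y: "y \<in> set t" "\<not> adj x y" for s t x y
  proof -
    obtain m q where t: "t = m # q" using y(1) by (cases t) auto
    have "adj x m"
      using induced_path_successively[OF r] by (auto simp: split t successively_append_iff)
    then have "r = (s @ [x]) @ m # q" "y \<in> set q" using split t y by auto
    then show ?thesis by (intro exI[of _ "s @ [x]"] exI[of _ m] exI[of _ q]) auto
  qed
  obtain s t where split: "r = s @ a # t" using ab(1) by (meson split_list)
  then consider "b \<in> set t" | "b \<in> set s" using ab by auto
  then show thesis
  proof cases
    case 1
    then obtain p m q where "r = p @ m # q" "a \<in> set p" "b \<in> set q"
      using ordered[OF split] ab(4) by blast
    then show thesis by (intro that) auto
  next
    case 2
    then obtain s1 s2 where "s = s1 @ b # s2" by (meson split_list)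
    then have "r = s1 @ b # (s2 @ a # t)" using split by simp
    moreover have "\<not> adj b a" using ab(4) adj_sym by blast
    ultimately obtain p m q where "r = p @ m # q" "b \<in> set p" "a \<in> set q"
      using ordered[of s1 b "s2 @ a # t" a] by auto
    then show thesis by (intro that) auto
  qed
qed

text \<open>The vertex \<open>m\<close> lies between \<open>a\<close> and \<open>b\<close> on the path \<open>C - y\<close>.\<close>

lemma hole_minus_between:
  assumes C: "C \<in> holes G" and y: "y \<in> verts C"
    and ab: "a \<in> verts C - {y}" "b \<in> verts C - {y}" "a \<noteq> b" "\<not> adj a b"
  obtains m p q where "m \<in> verts C" "m \<noteq> y" "{p, q} \<subseteq> verts C - {y, m}" "p \<noteq> q" "adj y p" "adj y q"
    "reach (verts C - {y, m}) p a" "reach (verts C - {y, m}) q b"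
proof -
  obtain r where r: "C = cycle_graph (y # r)" "induced_cycle y r"
    by (rule hole_induced_cycle[OF C y])
  have path: "induced_path r" "distinct r" "y \<notin> set r" "r \<noteq> []"
    and ends: "adj y (hd r)" "adj y (last r)"
    using r(2) by (auto simp: induced_cycle_def induced_path_def)
  obtain s m t where split: "r = s @ m # t"
    and sides: "a \<in> set s \<and> b \<in> set t \<or> b \<in> set s \<and> a \<in> set t"
    using induced_path_split_between[OF path(1), of a b] ab r(1) by auto
  let ?A = "verts C - {y, m}"
  have "successively adj s" "successively adj t"
    using induced_path_successively[OF path(1)]
    by (auto simp: split successively_append_iff successively_Cons)
  then have conn: "connected_set (set s)" "connected_set (set t)"
    by (simp_all add: connected_set_walk)
  have sub: "set s \<subseteq> ?A" "set t \<subseteq> ?A" using path r(1) split by auto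
  have "s \<noteq> []" "t \<noteq> []" using sides by auto
  then have "hd r \<in> set s" "last r \<in> set t" using split by auto
  then have from_ends: "x \<in> set s \<Longrightarrow> reach ?A (hd r) x" "x \<in> set t \<Longrightarrow> reach ?A (last r) x" for x
    using connected_setD conn sub by blast+
  have m: "m \<in> verts C" "m \<noteq> y" using r(1) path(3) split by auto
  have ends_in: "{hd r, last r} \<subseteq> ?A"
    using \<open>hd r \<in> set s\<close> \<open>last r \<in> set t\<close> sub by blast
  from sides obtain p q where pq: "{p, q} = {hd r, last r}" and "reach ?A p a" "reach ?A q b"
  proof
    assume "a \<in> set s \<and> b \<in> set t"
    then show thesis using from_ends by (intro that[of "hd r" "last r"]) auto
  next
    assume "b \<in> set s \<and> a \<in> set t"
    then show thesis using from_ends by (intro that[of "last r" "hd r"]) auto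
  qed
  moreover have "adj y p" "adj y q" "p \<noteq> q"
    using pq ends induced_cycle_ends_not_adj(1)[OF r(2)] by (auto simp: doubleton_eq_iff)
  ultimately show thesis using m ends_in that[of m p q] by simp
qed

lemma hole_through_edge:
  assumes A: "y \<notin> A" "z \<in> A" "w \<in> A" "w \<noteq> z" "reach A z w" and adj_y: "adj y z" "adj y w"
    and common: "\<And>x. x \<in> A \<Longrightarrow> adj y x \<Longrightarrow> \<not> adj z x"
  obtains D where "D \<in> holes G" "{y, z} \<in> edges D" "verts D \<subseteq> insert y A"
proof -
  let ?B = "{x \<in> A. adj y x \<longrightarrow> x = z}"
  have "\<not> reach ?B z w" using reach_in[of ?B z w] A adj_y by auto
  then obtain k c where "reach ?B z k" "k \<in> ?B" "adj k c" and c: "c \<in> A" "adj y c" "c \<noteq> z"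
    using reach_exit[OF A(5), of ?B] A(2) by blast
  then have "reach (insert c ?B) z k" "reach (insert c ?B) k c"
    using reach_mono by (blast, intro reach_step) auto
  then have "reach (insert c ?B) z c" by (rule reach_trans)
  then obtain p where p: "induced_path p" "set p \<subseteq> insert c ?B" "hd p = z" "last p = c"
    using reach_induced_path[of "insert c ?B" z c] A(2) adj_in_verts[OF adj_y(1)] by auto
  have "y \<notin> set p" using p(2) A(1) c(1) by auto
  have "p \<noteq> []" "distinct p" using p(1) by (auto simp: induced_path_def)
  have "\<not> adj z c" using common c by blast
  then have len: "3 \<le> length p"
    using p c(3) \<open>p \<noteq> []\<close> induced_path_successively[OF p(1)]
    by (cases p; cases "tl p"; cases "tl (tl p)") auto
  have "set p \<subseteq> insert c A" "z \<in> set p" "c \<in> set p" using p \<open>p \<noteq> []\<close> by auto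
  then have "induced_cycle y p"
    using p c(2) adj_y(1) adj_in_verts len \<open>y \<notin> set p\<close> unfolding induced_cycle_def by auto
  then have "cycle_graph (y # p) \<in> holes G"
    using cycle_graph_in_holes_iff_induced_cycle \<open>distinct p\<close> \<open>y \<notin> set p\<close> len by simp
  moreover have "verts (cycle_graph (y # p)) \<subseteq> insert y A" using p(2) c(1) by auto
  moreover from calculation have "{y, z} \<in> edges (cycle_graph (y # p))"
    using hole_adj_iff adj_y(1) \<open>z \<in> set p\<close> by simp
  ultimately show thesis using that by blast
qed

lemma not_K222_free_if_octahedron:
  assumes distinct: "distinct [a, a', b, b', c, c']"
    and not_adj: "\<not> adj a a'" "\<not> adj b b'" "\<not> adj c c'"
    and adj: "\<forall>x\<in>{a, a'}. \<forall>y\<in>{b, b', c, c'}. adj x y" "\<forall>x\<in>{b, b'}. \<forall>y\<in>{c, c'}. adj x y"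
  shows "\<not> K222_free G"
proof -
  define p where "p i = [[a, a'], [b, b'], [c, c']] ! fst i ! snd i" for i :: "nat \<times> nat"
  have p: "p (0, 0) = a" "p (0, Suc 0) = a'" "p (Suc 0, 0) = b" "p (Suc 0, Suc 0) = b'"
    "p (2, 0) = c" "p (2, Suc 0) = c'"
    by (simp_all add: p_def)
  have "isomorphic (induced_subgraph G (p ` verts K222)) K222"
  proof (rule isomorphic_induced_subgraph_image)
    show "inj_on p (verts K222)"
      using distinct by (auto simp: inj_on_def verts_K222 p)
    show "p ` verts K222 \<subseteq> verts G"
      using adj adj_in_verts by (auto simp: verts_K222 p)
    show "adj (p i) (p j) \<longleftrightarrow> {i, j} \<in> edges K222" if "i \<in> verts K222" "j \<in> verts K222" for i j
      unfolding edges_K222_iff using that adj not_adj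
      by (auto simp: verts_K222 p insert_commute)
  qed
  moreover have "p ` verts K222 \<subseteq> verts G"
    using adj adj_in_verts by (auto simp: verts_K222 p)
  ultimately show ?thesis unfolding K222_free_def by blast
qed

end

section \<open>Attachments to a hole\<close>

locale hole_edge_disjoint_graph = fin_graph +
  assumes disjoint: "hole_edge_disjoint G"
begin

lemma hole_unique: "C \<in> holes G \<Longrightarrow> D \<in> holes G \<Longrightarrow> f \<in> edges C \<Longrightarrow> f \<in> edges D \<Longrightarrow> D = C"
  using disjoint unfolding hole_edge_disjoint_def by blast

definition attachments :: "'a graph \<Rightarrow> 'a set \<Rightarrow> 'a set" where
  "attachments C K = {a \<in> verts C. \<exists>k\<in>K. adj a k}"

lemma attachments_subset: "attachments C K \<subseteq> verts C"
  by (auto simp: attachments_def)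

definition outside :: "'a graph \<Rightarrow> 'a set" where
  "outside C = verts G - (verts C \<union> X_hole G C)"

lemma outside_nonneighbour:
  assumes "x \<in> outside C"
  obtains y where "y \<in> verts C" "\<not> adj y x"
  using assms by (auto simp: outside_def X_hole_def)

lemma common_neighbour_of_attachments:
  assumes C: "C \<in> holes G" and K: "connected_set K" "K \<inter> verts C = {}"
    and uv: "u \<in> attachments C K" "v \<in> attachments C K" "adj u v"
  shows "\<exists>t\<in>K. adj u t \<and> adj v t"
proof (rule ccontr)
  assume no_common: "\<not> ?thesis"
  obtain k l where kl: "k \<in> K" "adj u k" "l \<in> K" "adj v l"
    using uv by (auto simp: attachments_def)
  have in_C: "u \<in> verts C" "v \<in> verts C" using uv attachments_subset by auto
  have "reach (insert v K) v l" using kl by (intro reach_step) auto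
  moreover have "reach (insert v K) l k" using kl by (intro connected_setD[OF K(1)]) auto
  ultimately have "reach (insert v K) v k" by (rule reach_trans)
  moreover have "u \<notin> insert v K" "k \<noteq> v" using in_C kl K(2) uv(3) by auto
  moreover have "\<not> adj v x" if "x \<in> insert v K" "adj u x" for x
    using that no_common by auto
  ultimately obtain D where D: "D \<in> holes G" "{u, v} \<in> edges D" "verts D \<subseteq> insert u (insert v K)"
    using hole_through_edge[of u "insert v K" v k] kl uv(3) by blast
  have "{u, v} \<in> edges C" using hole_adj_iff[OF C] in_C uv(3) by blast
  then have "D = C" using hole_unique D C by blast
  then have "verts C \<subseteq> {u, v}" using D(3) K(2) by auto
  then show False using hole_not_subset[OF C, of "{u, v}"] by (simp add: card_insert_if)
qed

lemma pairwise_adj_attachments_if_nonneighbour: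
  assumes C: "C \<in> holes G" and K: "connected_set K" "K \<inter> verts C = {}"
    and y: "y \<in> verts C" "y \<notin> attachments C K"
  shows "pairwise adj (attachments C K)"
proof (rule pairwiseI, rule ccontr)
  fix a b
  assume att: "a \<in> attachments C K" "b \<in> attachments C K" and ab: "a \<noteq> b" "\<not> adj a b"
  have "a \<in> verts C - {y}" "b \<in> verts C - {y}" using att attachments_subset y(2) by auto
  then obtain m p q where m: "m \<in> verts C" "m \<noteq> y"
    and pq: "{p, q} \<subseteq> verts C - {y, m}" "p \<noteq> q" "adj y p" "adj y q"
    and reach: "reach (verts C - {y, m}) p a" "reach (verts C - {y, m}) q b"
    using hole_minus_between[OF C y(1) _ _ ab] by blast
  obtain k l where kl: "k \<in> K" "adj a k" "l \<in> K" "adj b l"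
    using att by (auto simp: attachments_def)
  \<comment> \<open>Rerouting \<open>C\<close> through \<open>K\<close> gives a hole with the edge \<open>{y, p}\<close> of \<open>C\<close> that misses \<open>m\<close>.\<close>
  let ?A = "verts C - {y, m} \<union> K"
  have "{a, b} \<subseteq> ?A"
    using reach_in[OF reach(1)] reach_in[OF reach(2)] pq(1) by auto
  have "reach ?A p a" using reach(1) by (rule reach_mono) auto
  also have "reach ?A a k" using \<open>{a, b} \<subseteq> ?A\<close> kl by (intro reach_step) auto
  also have "reach ?A k l" using kl by (intro connected_setD[OF K(1)]) auto
  also have "reach ?A l b"
    using \<open>{a, b} \<subseteq> ?A\<close> kl by (intro reach_step) (auto simp: insert_commute)
  also have "reach ?A b q" using reach_sym[OF reach(2)] by (rule reach_mono) auto
  finally have "reach ?A p q" .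
  moreover have "\<not> adj p x" if "x \<in> ?A" "adj y x" for x
    using that y pq hole_no_triangle[OF C y(1), of p x] by (auto simp: attachments_def)
  moreover have "y \<notin> ?A" using y(1) K(2) by auto
  ultimately obtain D where D: "D \<in> holes G" "{y, p} \<in> edges D" "verts D \<subseteq> insert y ?A"
    using hole_through_edge[of y ?A p q] pq by blast
  have "{y, p} \<in> edges C" using hole_adj_iff[OF C y(1)] pq by blast
  then have "D = C" using hole_unique D C by blast
  then show False using D(3) m K(2) by auto
qed

lemma pairwise_adj_attachments_walk:
  assumes C: "C \<in> holes G" and "successively adj w" "set w \<subseteq> outside C"
  shows "pairwise adj (attachments C (set w))"
  using assms(2,3)
proof (induction w)
  case Nil
  then show ?case by (simp add: attachments_def)
next
  case (Cons x w)
  let ?K = "set (x # w)" and ?N = "attachments C {x}" and ?M = "attachments C (set w)"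
  have K: "connected_set ?K" "?K \<inter> verts C = {}"
    using Cons.prems by (auto intro: connected_set_walk simp del: list.set simp: outside_def)
  obtain y where "y \<in> verts C" "\<not> adj y x" using outside_nonneighbour[of x] Cons.prems(2) by auto
  then have N: "pairwise adj ?N"
    using K(2) by (intro pairwise_adj_attachments_if_nonneighbour[OF C])
      (auto simp: attachments_def connected_set_def)
  have M: "pairwise adj ?M" using Cons by (auto simp: successively_Cons)
  show ?case
  proof (rule ccontr)
    assume not_clique: "\<not> ?case"
    \<comment> \<open>Every edge of \<open>C\<close> then has a common neighbour in \<open>?K\<close>, so lies in one of the cliques
      \<open>?N\<close> and \<open>?M\<close>.\<close>
    have all_attached: "a \<in> attachments C ?K" if "a \<in> verts C" for a
      using pairwise_adj_attachments_if_nonneighbour[OF C K that] not_clique by blast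
    obtain a b where ab: "a \<in> verts C" "b \<in> verts C" "adj a b"
      and not_in: "\<not> {a, b} \<subseteq> ?N" "\<not> {a, b} \<subseteq> ?M"
      by (rule hole_edge_not_in_two_cliques[OF C N M])
    obtain t where "t \<in> ?K" "adj a t" "adj b t"
      using common_neighbour_of_attachments[OF C K] all_attached ab by blast
    then show False using ab(1,2) not_in by (auto simp: attachments_def)
  qed
qed

theorem pairwise_adj_attachments:
  assumes C: "C \<in> holes G" and K: "connected_set K" "K \<subseteq> outside C"
  shows "pairwise adj (attachments C K)"
proof (rule pairwiseI)
  fix a b assume ab: "a \<in> attachments C K" "b \<in> attachments C K" "a \<noteq> b"
  then obtain k l where kl: "k \<in> K" "adj a k" "l \<in> K" "adj b l" by (auto simp: attachments_def)
  have "reach K k l" using connected_setD[OF K(1)] kl by blast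
  then obtain w where w: "induced_path w" "set w \<subseteq> K" "hd w = k" "last w = l"
    using reach_induced_path[of K k l] kl K(2) by (auto simp: outside_def)
  then have "w \<noteq> []" by (simp add: induced_path_def)
  then have "k \<in> set w" "l \<in> set w" using w by auto
  then have "a \<in> attachments C (set w)" "b \<in> attachments C (set w)"
    using ab kl by (auto simp: attachments_def)
  moreover have "pairwise adj (attachments C (set w))"
    using w K(2) by (intro pairwise_adj_attachments_walk[OF C] induced_path_successively) auto
  ultimately show "adj a b" using ab(3) by (auto simp: pairwise_def)
qed

lemma hole_through_four_cycle:
  assumes "adj a x" "adj a y" "adj b x" "adj b y" "\<not> adj x y" "x \<noteq> y" "\<not> adj a b" "a \<noteq> b"
  obtains D where "D \<in> holes G" "{a, x} \<in> edges D" "verts D \<subseteq> {a, x, y, b}"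
proof -
  have "reach {x, y, b} x b" "reach {x, y, b} b y"
    using assms by (auto intro!: reach_step simp: insert_commute)
  then have "reach {x, y, b} x y" by (rule reach_trans)
  moreover have "\<not> adj x z" if "z \<in> {x, y, b}" "adj a z" for z using that assms by auto
  moreover have "a \<notin> {x, y, b}" using assms by auto
  ultimately show thesis
    using hole_through_edge[of a "{x, y, b}" x y] assms that by blast
qed

theorem pairwise_adj_X_hole:
  assumes "K222_free G" and C: "C \<in> holes G"
  shows "pairwise adj (X_hole G C)"
proof (rule pairwiseI, rule ccontr)
  fix x y assume xy: "x \<in> X_hole G C" "y \<in> X_hole G C" "x \<noteq> y" "\<not> adj x y"
  have adj_xy: "adj a x" "adj a y" if "a \<in> verts C" for a using xy that by (auto simp: X_hole_def)
  \<comment> \<open>Two non-neighbours \<open>b\<close>, \<open>c\<close> of \<open>a\<close> on \<open>C\<close> would give two holes \<open>a x b y\<close> and \<open>a x c y\<close> sharing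
    the edge \<open>{a, x}\<close>.\<close>
  have unique_nonneighbour: "b = c"
    if abc: "{a, b, c} \<subseteq> verts C" "a \<noteq> b" "\<not> adj a b" "a \<noteq> c" "\<not> adj a c" for a b c
  proof (rule ccontr)
    assume "b \<noteq> c"
    obtain D where D: "D \<in> holes G" "{a, x} \<in> edges D" "verts D \<subseteq> {a, x, y, b}"
      using hole_through_four_cycle[of a x y b] adj_xy xy abc by auto
    obtain D' where D': "D' \<in> holes G" "{a, x} \<in> edges D'" "verts D' \<subseteq> {a, x, y, c}"
      using hole_through_four_cycle[of a x y c] adj_xy xy abc by auto
    have "D' = D" using hole_unique D D' by blast
    moreover have "b \<noteq> x" "b \<noteq> y" using adj_xy[of b] abc(1) by auto
    ultimately have "verts D \<subseteq> {a, x, y}" using D(3) D'(3) \<open>b \<noteq> c\<close> abc by blast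
    then show False using hole_not_subset[OF D(1), of "{a, x, y}"] by (simp add: card_insert_if)
  qed
  obtain a b c d where C_path: "{a, b, c, d} \<subseteq> verts C" "adj a b" "adj b c" "adj c d"
    and diag: "a \<noteq> c" "\<not> adj a c" "b \<noteq> d" "\<not> adj b d"
    by (rule hole_consecutive[OF C])
  have "a \<noteq> d" using C_path(4) diag(2) adj_sym by blast
  then have "adj a d"
    using unique_nonneighbour[of d a b] C_path diag adj_sym by auto
  have "\<not> K222_free G"
  proof (rule not_K222_free_if_octahedron)
    show "distinct [a, c, b, d, x, y]"
      using C_path diag xy(3) \<open>a \<noteq> d\<close> adj_xy[of a] adj_xy[of b] adj_xy[of c] adj_xy[of d] by auto
    show "\<forall>p\<in>{a, c}. \<forall>q\<in>{b, d, x, y}. adj p q" "\<forall>p\<in>{b, d}. \<forall>q\<in>{x, y}. adj p q"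
      using C_path adj_xy \<open>adj a d\<close> adj_sym[OF C_path(3)] by auto
  qed (use diag xy(4) in auto)
  then show False using assms(1) by blast
qed

end

section \<open>The cut at an edge of a hole\<close>

locale edge_of_hole = hole_edge_disjoint_graph +
  fixes C e
  assumes hole: "C \<in> holes G" and edge: "e \<in> edges C"
begin

abbreviation (input) "X \<equiv> X_edge G C e"
abbreviation (input) "Q \<equiv> Q_edge G C e"
abbreviation (input) "T \<equiv> T_edge G C e"
abbreviation (input) "U \<equiv> U_edge G C e"
abbreviation (input) "U_components \<equiv>
  {K \<in> components (delete_verts (delete_verts G X) Q). K \<inter> T \<noteq> {}}"

lemma edge_subset: "e \<subseteq> verts C"
  using hole edge by (rule edge_of_hole_subset)

lemma edge_in_graph: "e \<in> edges G"
  using hole edge edges_hole_subset by blast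

lemma ends:
  obtains u v where "e = {u, v}" "u \<noteq> v" "adj u v" "u \<in> verts C" "v \<in> verts C"
proof -
  obtain u v where "e = {u, v}" "u \<noteq> v" "adj u v" by (rule edge_cases[OF edge_in_graph])
  then show thesis using that edge_subset by blast
qed

lemma X_edge_subset: "X \<subseteq> verts G"
  using edge_subset verts_hole_subset[OF hole] by (auto simp: X_edge_def X_hole_def)

lemma rest_subset: "verts C - e \<subseteq> verts G - X"
  using verts_hole_subset[OF hole] by (auto simp: X_edge_def X_hole_def)

lemma outside_eq: "outside C = verts G - X - (verts C - e)"
  using edge_subset by (auto simp: outside_def X_edge_def)

lemma rest_neighbour:
  obtains u q where "u \<in> e" "q \<in> verts C - e" "adj u q"
proof -
  obtain u v where uv: "e = {u, v}" "u \<noteq> v" "adj u v" "u \<in> verts C" "v \<in> verts C" by (rule ends)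
  obtain q where "q \<in> verts C" "q \<noteq> v" "adj u q" "\<not> adj v q"
    by (rule hole_other_neighbour[OF hole uv(4,5,3)])
  moreover from this have "q \<noteq> u" by auto
  ultimately show thesis using that uv(1) by auto
qed

lemma T_edge_iff: "t \<in> T \<longleftrightarrow> t \<in> outside C \<and> (\<forall>a\<in>e. adj a t)"
proof -
  have path_iff: "[a, t, b] \<in> avoiding_paths G C e \<longleftrightarrow> t \<in> outside C \<and> (\<forall>a\<in>e. adj a t)"
    if e: "e = {a, b}" for a b
  proof -
    have "a \<noteq> b" using edge_in_graph e by auto
    then have "is_path G [a, t, b] \<longleftrightarrow> adj a t \<and> adj b t"
      using adj_in_verts[of a t] adj_in_verts[of b t] by (auto simp: is_path_iff insert_commute)
    moreover have "avoiding G C [a, t, b] \<longleftrightarrow> t \<notin> verts C \<union> X_hole G C"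
      by (simp add: avoiding_def inner_verts_def)
    ultimately show ?thesis
      using adj_in_verts[of a t] by (auto simp: avoiding_paths_def outside_def e)
  qed
  obtain u v where "e = {u, v}" by (rule ends)
  then show ?thesis using path_iff unfolding T_edge_def by blast
qed

lemma attachments_T_edge:
  assumes t: "t \<in> T"
  shows "attachments C (reach_class (outside C) t) = e"
proof -
  let ?K = "reach_class (outside C) t"
  obtain u v where uv: "e = {u, v}" "u \<noteq> v" "u \<in> verts C" "v \<in> verts C" by (rule ends)
  have t_adj: "t \<in> outside C" "adj u t" "adj v t" using t[unfolded T_edge_iff] uv(1) by auto
  have "?K \<subseteq> outside C" using reach_in[OF _ t_adj(1)] by blast
  then have "pairwise adj (attachments C ?K)"
    using pairwise_adj_attachments[OF hole] connected_set_reach_class by blast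
  moreover have "{u, v} \<subseteq> attachments C ?K"
    using t_adj uv(3,4) reach_refl unfolding attachments_def by blast
  ultimately show ?thesis
    using hole_clique_eq_doubleton[OF hole attachments_subset] uv(1,2) by simp
qed

lemma Q_edge_eq:
  assumes q: "q \<in> verts C - e"
  shows "Q = reach_class (verts G - X) q"
  unfolding Q_edge_def components_delete
proof (rule the_equality, intro conjI)
  show "reach_class (verts G - X) q \<in> reach_class (verts G - X) ` (verts G - X)"
    using rest_subset q by blast
  obtain u v where "e = {u, v}" by (rule ends)
  then have "connected_set (verts C - e)"
    using hole_minus_edge_connected[OF hole] edge by simp
  then show "verts C - e \<subseteq> reach_class (verts G - X) q"
    using connected_setD[OF _ rest_subset q] by blast
  fix K assume "K \<in> reach_class (verts G - X) ` (verts G - X) \<and> verts C - e \<subseteq> K"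
  then show "K = reach_class (verts G - X) q" using q reach_class_eq_iff by blast
qed

lemma rest_subset_Q_edge: "verts C - e \<subseteq> Q"
  using Q_edge_eq by fastforce

lemma T_edge_not_in_Q_edge:
  assumes t: "t \<in> T"
  shows "t \<notin> Q"
proof
  assume "t \<in> Q"
  obtain q where q: "q \<in> verts C - e" using rest_neighbour by metis
  have "reach (verts G - X) t q" using \<open>t \<in> Q\<close> Q_edge_eq[OF q] reach_sym by blast
  moreover have t_outside: "t \<in> outside C" using t by (simp add: T_edge_iff)
  moreover have "outside C \<subseteq> verts G - X" using outside_eq by blast
  moreover have "\<not> reach (outside C) t q"
    using reach_in[OF _ t_outside] q by (auto simp: outside_def)
  ultimately obtain k c where k: "reach (outside C) t k" "k \<in> outside C"
    and "c \<in> verts G - X - outside C" and kc: "adj k c"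
    by (rule reach_exit)
  then have c: "c \<in> verts C - e" using outside_eq by blast
  then have "c \<in> attachments C (reach_class (outside C) t)"
    using k(1) adj_sym[OF kc] by (auto simp: attachments_def)
  then show False using attachments_T_edge[OF t] c by blast
qed

lemma U_edge_reach_T_edge:
  assumes "x \<in> U"
  obtains t where "t \<in> T" "reach (outside C) x t"
proof -
  let ?A = "verts G - X - Q"
  obtain K t where K: "K \<in> components (induced_subgraph G ?A)" "x \<in> K" "t \<in> K" "t \<in> T"
    using assms unfolding U_edge_def delete_verts_twice by blast
  have "K \<in> reach_class ?A ` ?A" using K(1) by (subst (asm) components_induced) auto
  then obtain k where "reach ?A k x" "reach ?A k t" using K by blast
  then have "reach ?A x t" using reach_trans[OF reach_sym] by blast
  moreover have "?A \<subseteq> outside C" using rest_subset_Q_edge outside_eq by blast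
  ultimately show thesis using that K(4) reach_mono by blast
qed

lemma U_edge_subset: "U \<subseteq> outside C"
proof
  fix x assume "x \<in> U"
  then obtain t where "t \<in> T" "reach (outside C) x t" by (rule U_edge_reach_T_edge)
  then show "x \<in> outside C" using reach_in[OF reach_sym] by (auto simp: T_edge_iff)
qed

lemma attachments_U_edge:
  assumes "x \<in> U"
  shows "attachments C (reach_class (outside C) x) = e"
proof -
  obtain t where "t \<in> T" "reach (outside C) x t" using assms by (rule U_edge_reach_T_edge)
  then show ?thesis using attachments_T_edge reach_class_eq_iff by metis
qed

lemma T_edge_nonempty:
  assumes "S_edge G C e \<noteq> {}"
  shows "T \<noteq> {}"
proof -
  obtain s p where "p \<in> avoiding_paths G C e" and s: "s \<in> set p" "s \<notin> e"
    using assms unfolding S_edge_def by auto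
  then have p: "is_path G p" "{hd p, last p} = e" "avoiding G C p"
    by (auto simp: avoiding_paths_def)
  have "hd p \<noteq> last p" using p(2) edge_in_graph by auto
  with p(1) obtain h m l where split: "p = h # m @ [l]"
    by (cases p; cases "tl p" rule: rev_cases) (auto simp: is_path_iff)
  then have e: "e = {h, l}" and "m \<noteq> []" using p(2) s by auto
  have path: "successively adj m" "adj h (hd m)" "adj l (last m)"
    using p(1) \<open>m \<noteq> []\<close>
    by (auto simp: is_path_iff split successively_Cons successively_append_iff insert_commute)
  have m: "set m \<subseteq> outside C"
    using p(1,3)
    by (auto simp: is_path_iff avoiding_def inner_verts_def outside_def split butlast_append)
  have "{h, l} \<subseteq> attachments C (set m)"
    using path \<open>m \<noteq> []\<close> edge_subset e by (auto simp: attachments_def)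
  moreover have "adj h l" using edge_in_graph e by simp
  moreover have "set m \<inter> verts C = {}" using m by (auto simp: outside_def)
  ultimately obtain t where "t \<in> set m" "adj h t" "adj l t"
    using common_neighbour_of_attachments[OF hole connected_set_walk[OF path(1)]] by blast
  then show ?thesis using T_edge_iff m e by blast
qed

lemma U_components_subset: "U_components \<subseteq> components (delete_verts G X)"
proof -
  obtain q where "q \<in> verts C - e" using rest_neighbour by metis
  then have Q: "Q = reach_class (verts G - X) q" by (rule Q_edge_eq)
  have "components (delete_verts (delete_verts G X) Q) =
      reach_class (verts G - X - Q) ` (verts G - X - Q)"
    unfolding delete_verts_twice by (rule components_induced) blast
  also have "\<dots> = reach_class (verts G - X) ` (verts G - X - Q)"
    unfolding Q by (intro image_cong reach_class_Diff_reach_class refl)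
  finally show ?thesis unfolding components_delete by blast
qed

lemma U_components_nonempty:
  assumes t: "t \<in> T"
  shows "U_components \<noteq> {}"
proof -
  have "t \<in> verts G - X - Q" using t T_edge_not_in_Q_edge by (auto simp: T_edge_iff outside_eq)
  then have "reach_class (verts G - X - Q) t \<in> components (delete_verts (delete_verts G X) Q)"
    unfolding delete_verts_twice by (subst components_induced) auto
  moreover have "t \<in> reach_class (verts G - X - Q) t" by simp
  ultimately show ?thesis using t by blast
qed

lemma pairwise_adj_X_edge:
  assumes "K222_free G"
  shows "pairwise adj X"
proof -
  have "adj a b" "adj b a" if "a \<in> e" "b \<in> X_hole G C" for a b
    using that edge_subset by (auto simp: X_hole_def insert_commute)
  moreover obtain u v where "e = {u, v}" "adj u v" using ends by metis
  then have "pairwise adj e" using adj_sym by (auto simp: pairwise_def)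
  ultimately show ?thesis
    using pairwise_adj_X_hole[OF assms hole] unfolding X_edge_def pairwise_def by blast
qed

lemma clique_cut_X_edge:
  assumes "K222_free G" and t: "t \<in> T"
  shows "clique_cut G X"
proof -
  obtain u q where u: "u \<in> e" and q: "q \<in> verts C - e" "adj u q" by (rule rest_neighbour)
  show ?thesis
  proof (rule clique_cut_if_separates)
    show "X \<subseteq> verts G" by (rule X_edge_subset)
    show "pairwise adj X" using assms(1) by (rule pairwise_adj_X_edge)
    show "q \<in> verts G - X" using rest_subset q(1) by blast
    show "t \<in> verts G - X" using t by (auto simp: T_edge_iff outside_eq)
    show "\<not> reach (verts G - X) q t" using T_edge_not_in_Q_edge[OF t] Q_edge_eq[OF q(1)] by blast
    have "adj u t" using t u by (simp add: T_edge_iff)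
    then have "reach (verts G) q u" "reach (verts G) u t"
      using q(2) adj_in_verts adj_sym by (auto intro!: reach_step)
    then show "reach (verts G) q t" by (rule reach_trans)
  qed
qed

theorem chordal_cut_X_edge:
  assumes "K222_free G" "S_edge G C e \<noteq> {}" "chordal (induced_subgraph G (U \<union> X))"
  shows "chordal_cut G X"
proof -
  obtain t where t: "t \<in> T" using T_edge_nonempty[OF assms(2)] by blast
  have "chordal (induced_subgraph G (\<Union> U_components \<union> X))"
    using assms(3) by (simp add: U_edge_def)
  then show ?thesis
    unfolding chordal_cut_def
    using clique_cut_X_edge[OF assms(1) t] U_components_subset U_components_nonempty[OF t] by blast
qed

lemma hole_meets_U_edge:
  assumes "K222_free G" "D \<in> holes (induced_subgraph G (U \<union> X))"
  shows "D \<in> holes G - {C}" "verts D \<inter> U \<noteq> {}"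
proof -
  have D: "D \<in> holes G" "verts D \<subseteq> U \<union> X" using holes_induced_subgraph[OF assms(2)] by auto
  obtain q where "q \<in> verts C - e" using rest_neighbour by metis
  then have "q \<in> verts C" "q \<notin> U \<union> X"
    using rest_subset U_edge_subset by (auto simp: outside_def)
  then show "D \<in> holes G - {C}" using D by blast
  have "\<not> verts D \<subseteq> X"
    using hole_not_clique[OF D(1)] pairwise_subset[OF pairwise_adj_X_edge[OF assms(1)]] by blast
  then show "verts D \<inter> U \<noteq> {}" using D(2) by blast
qed

end

context hole_edge_disjoint_graph
begin

lemma U_edge_disjoint_other_edge:
  assumes "C \<in> holes G" "e \<in> edges C" "f \<in> edges C" "e \<noteq> f"
  shows "U_edge G C e \<inter> (U_edge G C f \<union> X_edge G C f) = {}"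
proof -
  interpret e: edge_of_hole G C e by unfold_locales (use assms in auto)
  interpret f: edge_of_hole G C f by unfold_locales (use assms in auto)
  have "U_edge G C e \<inter> U_edge G C f = {}"
    using e.attachments_U_edge f.attachments_U_edge assms(4) by blast
  moreover have "U_edge G C e \<inter> X_edge G C f = {}"
    using e.U_edge_subset f.outside_eq by blast
  ultimately show ?thesis by blast
qed

theorem exists_edge_with_chordal_side:
  assumes "K222_free G" and C: "C \<in> holes G" and F: "F \<subseteq> edges C" "card (holes G) \<le> card F"
  obtains e where "e \<in> F" "chordal (induced_subgraph G (U_edge G C e \<union> X_edge G C e))"
proof (rule ccontr)
  assume "\<not> thesis"
  then have "\<forall>e\<in>F. \<exists>D. D \<in> holes (induced_subgraph G (U_edge G C e \<union> X_edge G C e))"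
    using that by (auto simp: chordal_def)
  then obtain H where
    H: "\<And>e. e \<in> F \<Longrightarrow> H e \<in> holes (induced_subgraph G (U_edge G C e \<union> X_edge G C e))"
    by metis
  have edge: "edge_of_hole G C e" if "e \<in> F" for e
    by unfold_locales (use that C F in auto)
  have "inj_on H F"
  proof (rule inj_onI, rule ccontr)
    fix e f assume ef: "e \<in> F" "f \<in> F" "H e = H f" "e \<noteq> f"
    have "verts (H e) \<inter> U_edge G C e \<noteq> {}"
      using edge_of_hole.hole_meets_U_edge(2)[OF edge assms(1)] H ef(1) by blast
    moreover have "verts (H e) \<subseteq> U_edge G C f \<union> X_edge G C f"
      using holes_induced_subgraph(2)[OF H[OF ef(2)]] ef(3) by simp
    ultimately show False using U_edge_disjoint_other_edge[OF C _ _ ef(4)] ef(1,2) F(1) by blast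
  qed
  moreover have "H ` F \<subseteq> holes G - {C}"
    using edge_of_hole.hole_meets_U_edge(1)[OF edge assms(1)] H by blast
  ultimately have "card F \<le> card (holes G - {C})" using finite_holes by (intro card_inj_on_le) auto
  also have "\<dots> < card (holes G)" using finite_holes C by (rule card_Diff1_less)
  finally show False using F(2) by simp
qed

end

theorem theorem2p2:
  fixes G :: "'a graph"
  assumes "finite_simple_graph G"
    and "K222_free G"
    and "hole_edge_disjoint G"
    and "\<exists>C\<in>holes G. card {e \<in> edges C. S_edge G C e \<noteq> {}} \<ge> card (holes G)"
  shows "chordal_property G \<and> (\<exists>X. chordal_cut G X)"
proof -
  interpret hole_edge_disjoint_graph G by standard (rule assms)+
  obtain C where C: "C \<in> holes G" and "card (holes G) \<le> card {e \<in> edges C. S_edge G C e \<noteq> {}}"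
    using assms(4) by blast
  then obtain e where e: "e \<in> edges C" "S_edge G C e \<noteq> {}"
    and chordal: "chordal (induced_subgraph G (U_edge G C e \<union> X_edge G C e))"
    using exists_edge_with_chordal_side[OF assms(2) C, of "{e \<in> edges C. S_edge G C e \<noteq> {}}"]
    by blast
  interpret edge_of_hole G C e by unfold_locales (rule C, rule e(1))
  have "chordal_property G" unfolding chordal_property_def using C e(1) chordal by blast
  moreover have "chordal_cut G (X_edge G C e)"
    using assms(2) e(2) chordal by (rule chordal_cut_X_edge)
  ultimately show ?thesis by blast
qed

end
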